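(* Let $c>0$ and let $(\nu_n)_{n\in\mathbb{N}}$ be a sequence of point processes on $(0,\infty)$ converging vaguely in distribution to $\eta_c$ as $n\to\infty$. If $$\lim_{\varepsilon\to0}\limsup_{n\to\infty}\mathbf{E}\int_0^\varepsilon t\,\nu_n(dt)=0,$$ then $$\int_0^1 t\,\nu_n(dt)\longrightarrow\int_0^1 t\,\eta_c(dt)=_d D_c\quad\text{in distribution as } n\to\infty.$$
   Context: For $c>0$, $\eta_c$ denotes the Poisson process on $(0,\infty)$ with intensity measure $c t^{-1}\,dt$. $D_c$ is the generalized Dickman random variable with parameter $c$, whose law is that of the sum of the points of $\eta_c$ in $(0,1)$. Integrals $\int_0^x$ are over $(0,x]$. Point processes $\xi_n$ on $(0,\infty)$ converge vaguely in distribution to $\xi$ if they converge in distribution as random elements of the space of locally finite measures on $(0,\infty)$ with the vague topology; equivalently, $\int f\,d\xi_n\to\int f\,d\xi$ in distribution for every bounded non-negative continuous $f$ on $(0,\infty)$ with relatively compact support. *)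

theory Defs
  imports "HOL-Probability.Probability"
begin

section \<open>Convergence in distribution in a topological space\<close>

text \<open>The \<open>X n\<close> may live on different probability spaces \<open>M n\<close>; the limit \<open>Y\<close> lives on \<open>N\<close>.\<close>

definition conv_in_distribution ::
    "'e topology \<Rightarrow> (nat \<Rightarrow> 'a measure) \<Rightarrow> (nat \<Rightarrow> 'a \<Rightarrow> 'e) \<Rightarrow> 'b measure \<Rightarrow> ('b \<Rightarrow> 'e) \<Rightarrow> bool" where
  "conv_in_distribution T M X N Y \<longleftrightarrow>
     (\<forall>F :: 'e \<Rightarrow> real. continuous_map T euclidean F \<longrightarrow> bounded (F ` topspace T) \<longrightarrow>
        (\<lambda>n. \<integral>\<omega>. F (X n \<omega>) \<partial>M n) \<longlonglongrightarrow> (\<integral>\<omega>. F (Y \<omega>) \<partial>N))"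

text \<open>For real random variables this is the weak convergence of laws of the library.\<close>

lemma conv_in_distribution_real_iff_weak_conv_m:
  fixes X :: "nat \<Rightarrow> 'a \<Rightarrow> real" and Y :: "'b \<Rightarrow> real"
  assumes "\<And>n. prob_space (M n)" "prob_space N"
    and [measurable]: "\<And>n. X n \<in> borel_measurable (M n)" "Y \<in> borel_measurable N"
  shows "conv_in_distribution euclidean M X N Y \<longleftrightarrow>
           weak_conv_m (\<lambda>n. distr (M n) borel (X n)) (distr N borel Y)"
proof
  have rd: "real_distribution (distr (M n) borel (X n))" for n
    using assms(1)[of n] by (intro prob_space.real_distribution_distr) auto
  have rd': "real_distribution (distr N borel Y)"
    using assms(2) by (intro prob_space.real_distribution_distr) auto
  have eq: "integral\<^sup>L (distr (M n) borel (X n)) F = (\<integral>\<omega>. F (X n \<omega>) \<partial>M n)"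
           "integral\<^sup>L (distr N borel Y) F = (\<integral>\<omega>. F (Y \<omega>) \<partial>N)"
    if "continuous_on UNIV F" for n and F :: "real \<Rightarrow> real"
    using borel_measurable_continuous_onI[OF that] by (auto intro!: integral_distr)
  {
    assume L: "conv_in_distribution euclidean M X N Y"
    show "weak_conv_m (\<lambda>n. distr (M n) borel (X n)) (distr N borel Y)"
    proof (rule integral_bdd_continuous_conv_imp_weak_conv[OF rd rd'])
      fix f :: "real \<Rightarrow> real"
      assume f: "\<And>x. isCont f x" "\<And>x. \<bar>f x\<bar> \<le> 1"
      have c: "continuous_on UNIV f" using f(1) by (simp add: continuous_at_imp_continuous_on)
      have b: "bounded (range f)" using f(2) by (auto simp: bounded_iff)
      show "(\<lambda>n. integral\<^sup>L (distr (M n) borel (X n)) f) \<longlonglongrightarrow> integral\<^sup>L (distr N borel Y) f"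
        using L c b by (simp add: eq conv_in_distribution_def)
    qed
  next
    assume R: "weak_conv_m (\<lambda>n. distr (M n) borel (X n)) (distr N borel Y)"
    show "conv_in_distribution euclidean M X N Y"
      unfolding conv_in_distribution_def
    proof (intro allI impI)
      fix F :: "real \<Rightarrow> real"
      assume "continuous_map euclidean euclidean F" and b: "bounded (F ` topspace euclidean)"
      then have c: "continuous_on UNIV F" by simp
      obtain B where B: "\<And>x. norm (F x) \<le> B" using b by (auto simp: bounded_iff)
      have "(\<lambda>n. integral\<^sup>L (distr (M n) borel (X n)) F) \<longlonglongrightarrow> integral\<^sup>L (distr N borel Y) F"
        by (rule weak_conv_imp_integral_bdd_continuous_conv[OF rd rd' R _ B])
           (use c in \<open>simp add: continuous_on_eq_continuous_at\<close>)
      then show "(\<lambda>n. \<integral>\<omega>. F (X n \<omega>) \<partial>M n) \<longlonglongrightarrow> (\<integral>\<omega>. F (Y \<omega>) \<partial>N)"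
        by (simp add: eq[OF c])
    qed
  }
qed


section \<open>Locally finite measures on the positive half-line\<close>

abbreviation pos_borel :: "real measure" where
  "pos_borel \<equiv> restrict_space borel {0<..}"

definition lf_measures :: "real measure set" where
  "lf_measures = {\<mu>. sets \<mu> = sets pos_borel \<and>
     (\<forall>K. compact K \<and> K \<subseteq> {0<..} \<longrightarrow> emeasure \<mu> K < \<infinity>)}"

definition vague_test_functions :: "(real \<Rightarrow> real) set" where
  "vague_test_functions = {f. continuous_on {0<..} f \<and> bounded (f ` {0<..}) \<and> (\<forall>t>0. 0 \<le> f t) \<and>
     (\<exists>K. compact K \<and> K \<subseteq> {0<..} \<and> (\<forall>t\<in>{0<..} - K. f t = 0))}"

text \<open>The coarsest topology making all \<open>\<mu> \<mapsto> \<integral>f d\<mu>\<close> continuous.\<close>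

definition vague_topology :: "real measure topology" where
  "vague_topology = topology_generated_by
     {{\<mu> \<in> lf_measures. integral\<^sup>L \<mu> f \<in> U} | f U. f \<in> vague_test_functions \<and> open U}"

lemma topspace_vague_topology: "topspace vague_topology = lf_measures"
proof -
  have "(\<lambda>_. 0) \<in> vague_test_functions"
    by (auto simp: vague_test_functions_def bounded_iff intro!: exI[of _ "{}"])
  then have "lf_measures \<in> {{\<mu> \<in> lf_measures. integral\<^sup>L \<mu> f \<in> U} | f U. f \<in> vague_test_functions \<and> open U}"
    by (auto intro!: exI[of _ "\<lambda>_. 0"] exI[of _ UNIV])
  then show ?thesis unfolding vague_topology_def topology_generated_by_topspace by blast
qed

text \<open>As for \<^const>\<open>subprob_algebra\<close>, the \<open>\<sigma>\<close>-algebra is generated by the evaluations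
  \<open>\<mu> \<mapsto> \<mu> A\<close>; it is also the Borel \<open>\<sigma>\<close>-algebra of the vague topology.\<close>

definition lf_algebra :: "real measure measure" where
  "lf_algebra = (SUP A \<in> sets pos_borel. vimage_algebra lf_measures (\<lambda>\<mu>. emeasure \<mu> A) borel)"

lemma space_lf_algebra: "space lf_algebra = lf_measures"
  using sets.empty_sets[of pos_borel] by (auto simp: lf_algebra_def space_Sup_eq_UN)


section \<open>Point processes and Poisson processes\<close>

text \<open>A point configuration is identified with its counting measure (with multiplicities), so
  \<open>\<integral> t \<xi>(dt)\<close> over a set is the sum of the points of \<open>\<xi>\<close> in that set.\<close>

definition point_process :: "'a measure \<Rightarrow> ('a \<Rightarrow> real measure) \<Rightarrow> bool" where
  "point_process M \<xi> \<longleftrightarrow> prob_space M \<and> \<xi> \<in> M \<rightarrow>\<^sub>M lf_algebra \<and>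
     (\<forall>\<omega>\<in>space M. \<forall>A\<in>sets pos_borel. emeasure (\<xi> \<omega>) A \<in> insert \<infinity> (range of_nat))"

text \<open>The degenerate cases \<open>r = 0\<close> and \<open>r = \<infinity>\<close> are point masses; \<^const>\<open>poisson_pmf\<close> is
  only specified for positive finite rates.\<close>

definition poisson_law :: "ennreal \<Rightarrow> ennreal measure" where
  "poisson_law r = (if r = 0 \<or> r = \<infinity> then return borel r
                    else distr (measure_pmf (poisson_pmf (enn2real r))) borel of_nat)"

definition poisson_process :: "real measure \<Rightarrow> 'a measure \<Rightarrow> ('a \<Rightarrow> real measure) \<Rightarrow> bool" where
  "poisson_process \<Lambda> M \<xi> \<longleftrightarrow> point_process M \<xi> \<and>
     (\<forall>A\<in>sets pos_borel. distr M borel (\<lambda>\<omega>. emeasure (\<xi> \<omega>) A) = poisson_law (emeasure \<Lambda> A)) \<and>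
     (\<forall>(A :: nat \<Rightarrow> real set) I. finite I \<longrightarrow> A ` I \<subseteq> sets pos_borel \<longrightarrow> disjoint_family_on A I \<longrightarrow>
        prob_space.indep_vars M (\<lambda>_. borel) (\<lambda>i \<omega>. emeasure (\<xi> \<omega>) (A i)) I)"

definition dickman_intensity :: "real \<Rightarrow> real measure" where
  "dickman_intensity c = density (restrict_space lborel {0<..}) (\<lambda>t. ennreal (c / t))"

text \<open>The law of the sum does not depend on the chosen Poisson process, so its sample space may be
  any standard Borel space, here one on \<^typ>\<open>real\<close>. The sum of the points in \<open>(0,1)\<close> has mean
  \<open>c\<close> and is therefore almost surely finite, so \<^const>\<open>enn2real\<close> loses nothing.\<close>

definition gen_dickman :: "real \<Rightarrow> 'a measure \<Rightarrow> ('a \<Rightarrow> real) \<Rightarrow> bool" where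
  "gen_dickman c P D \<longleftrightarrow> prob_space P \<and> D \<in> borel_measurable P \<and>
     (\<exists>(Q :: real measure) \<eta>. poisson_process (dickman_intensity c) Q \<eta> \<and>
        distr P borel D = distr Q borel (\<lambda>\<omega>. enn2real (\<integral>\<^sup>+t\<in>{0<..<1}. ennreal t \<partial>\<eta> \<omega>)))"

end

theory Submission
  imports Defs
begin

text \<open>
  The sum \<open>S\<close> of the points in \<open>(0, 1]\<close> is not a vaguely continuous function of the configuration, for
  two reasons: the integrand \<open>t\<close> on \<open>(0, 1]\<close> does not vanish near \<open>0\<close>, and it jumps at \<open>1\<close>. Replacing
  it by a continuous function with compact support, equal to \<open>t\<close> on \<open>[\<epsilon>, 1]\<close> and to \<open>0\<close> outside
  \<open>(\<epsilon>/2, 1 + \<epsilon>)\<close>, gives a sum \<open>T\<close> whose law converges by vague convergence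
  (\<open>conv_in_distribution_vague_integral\<close>), for every \<open>\<epsilon>\<close>. It remains to bound the
  difference between the expectations of \<open>F S\<close> and \<open>F T\<close>, for a bounded continuous \<open>F\<close>, uniformly in
  large \<open>n\<close> and for the limit process (\<open>expected_truncation_error\<close>).

  Since \<open>[0, \<infinity>]\<close> is compact, \<open>F\<close> is uniformly continuous, so \<open>F S\<close> is close to \<open>F T\<close> unless either the points
  in \<open>(0, \<epsilon>]\<close> have a large sum \<open>R\<close> or there is a point in \<open>(1, 1 + \<epsilon>)\<close>. The first event is rare by Markov's
  inequality: the mean of \<open>R\<close> is small by hypothesis for the approximating processes, and
  equals \<open>c * \<epsilon>\<close> for the limit by Campbell's formula (\<open>poisson_process_mean\<close>). The second event has
  probability at most the mean of \<open>min 1 H\<close>, where \<open>H\<close> is the integral of a continuous majorant of the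
  indicator of that interval. For the limit this is of order \<open>c * \<epsilon>\<close>, again by Campbell's formula;
  and as \<open>min 1 H\<close> is itself a bounded continuous function of the configuration, vague convergence
  carries the bound over to the approximating processes.

  The limit has the Dickman law because the law of an integral against a Poisson process
  depends on the intensity only (\<open>poisson_process_integral_law_unique\<close>): for simple integrands by
  independence over disjoint sets, in general by monotone approximation.
\<close>

section \<open>Integrals against random measures\<close>

lemma measurable_emeasure_lf_algebra:
  "A \<in> sets pos_borel \<Longrightarrow> (\<lambda>\<mu>. emeasure \<mu> A) \<in> borel_measurable lf_algebra"
  by (auto intro!: measurable_Sup1 measurable_vimage_algebra1 simp: lf_algebra_def)

lemma lf_measuresD:
  assumes "\<mu> \<in> lf_measures"
  shows "sets \<mu> = sets pos_borel" "space \<mu> = {0<..}"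
proof -
  show s: "sets \<mu> = sets pos_borel" using assms by (simp add: lf_measures_def)
  show "space \<mu> = {0<..}" using sets_eq_imp_space_eq[OF s] by (simp add: space_restrict_space)
qed

lemma borel_measurable_lf_measure:
  "\<mu> \<in> lf_measures \<Longrightarrow> borel_measurable \<mu> = borel_measurable pos_borel"
  by (rule measurable_cong_sets) (simp_all add: lf_measuresD)

lemma measurable_nn_integral_lf_algebra:
  fixes f :: "real \<Rightarrow> ennreal"
  assumes "f \<in> borel_measurable pos_borel"
  shows "(\<lambda>\<mu>. \<integral>\<^sup>+t. f t \<partial>\<mu>) \<in> borel_measurable lf_algebra"
  using assms
proof (induction rule: borel_measurable_induct)
  case (cong f g)
  have eq: "(\<integral>\<^sup>+t. g t \<partial>\<mu>) = (\<integral>\<^sup>+t. f t \<partial>\<mu>)" if "\<mu> \<in> space lf_algebra" for \<mu>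
    using that cong(3) by (intro nn_integral_cong) (auto simp: lf_measuresD space_lf_algebra)
  show ?case using cong(4) by (simp add: measurable_cong[OF eq])
next
  case (set A)
  have eq: "(\<integral>\<^sup>+t. indicator A t \<partial>\<mu>) = emeasure \<mu> A" if "\<mu> \<in> space lf_algebra" for \<mu>
    using that set by (intro nn_integral_indicator) (auto simp: lf_measuresD space_lf_algebra)
  show ?case using measurable_emeasure_lf_algebra[OF set] by (simp add: measurable_cong[OF eq])
next
  case (mult u c)
  have eq: "(\<integral>\<^sup>+t. c * u t \<partial>\<mu>) = c * (\<integral>\<^sup>+t. u t \<partial>\<mu>)" if "\<mu> \<in> space lf_algebra" for \<mu>
    using that mult by (intro nn_integral_cmult) (auto simp: borel_measurable_lf_measure space_lf_algebra)
  show ?case using mult(4) by (simp add: measurable_cong[OF eq])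
next
  case (add u v)
  have eq: "(\<integral>\<^sup>+t. v t + u t \<partial>\<mu>) = (\<integral>\<^sup>+t. v t \<partial>\<mu>) + (\<integral>\<^sup>+t. u t \<partial>\<mu>)" if "\<mu> \<in> space lf_algebra" for \<mu>
    using that add by (intro nn_integral_add) (auto simp: borel_measurable_lf_measure space_lf_algebra)
  show ?case using add by (simp add: measurable_cong[OF eq])
next
  case (seq U)
  have eq: "(\<integral>\<^sup>+t. (SUP i. U i) t \<partial>\<mu>) = (SUP i. \<integral>\<^sup>+t. U i t \<partial>\<mu>)" if "\<mu> \<in> space lf_algebra" for \<mu>
    using that seq unfolding SUP_apply
    by (intro nn_integral_monotone_convergence_SUP) (auto simp: borel_measurable_lf_measure space_lf_algebra)
  have "(\<lambda>\<mu>. SUP i. \<integral>\<^sup>+t. U i t \<partial>\<mu>) \<in> borel_measurable lf_algebra"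
    using seq by (intro borel_measurable_SUP) auto
  then have "(\<lambda>\<mu>. \<integral>\<^sup>+t. (SUP i. U i) t \<partial>\<mu>) \<in> borel_measurable lf_algebra"
    by (subst measurable_cong[OF eq])
  then show ?case by (simp only:)
qed

lemma point_processD:
  assumes "point_process M \<xi>"
  shows "prob_space M" "\<And>\<omega>. \<omega> \<in> space M \<Longrightarrow> \<xi> \<omega> \<in> lf_measures"
  using assms by (auto simp: point_process_def space_lf_algebra dest: measurable_space)

lemma measurable_nn_integral_point_process:
  assumes "point_process M \<xi>" "f \<in> borel_measurable pos_borel"
  shows "(\<lambda>\<omega>. \<integral>\<^sup>+t. f t \<partial>\<xi> \<omega>) \<in> borel_measurable M"
  using measurable_compose[OF _ measurable_nn_integral_lf_algebra[OF assms(2)]] assms(1)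
  by (auto simp: point_process_def)

lemma measurable_emeasure_point_process:
  assumes "point_process M \<xi>" "A \<in> sets pos_borel"
  shows "(\<lambda>\<omega>. emeasure (\<xi> \<omega>) A) \<in> borel_measurable M"
  using measurable_compose[OF _ measurable_emeasure_lf_algebra[OF assms(2)]] assms(1)
  by (auto simp: point_process_def)


section \<open>The mean of a Poisson integral\<close>

lemma nn_integral_poisson_law: "(\<integral>\<^sup>+x. x \<partial>poisson_law r) = r"
proof (cases "r = 0 \<or> r = \<infinity>")
  case True
  then show ?thesis by (auto simp: poisson_law_def nn_integral_return)
next
  case False
  define q where "q = enn2real r"
  have q: "q > 0" "r = ennreal q"
    using False by (auto simp: q_def enn2real_positive_iff less_top zero_less_iff_neq_zero)
  have "(\<lambda>k. q * exp (- q) * (q ^ k / fact k)) sums (q * exp (- q) * exp q)"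
    using sums_mult[OF exp_converges[of q], of "q * exp (- q)"] by (simp add: field_simps)
  then have "(\<lambda>k. q ^ Suc k / fact (Suc k) * exp (- q) * real (Suc k)) sums q"
    by (simp add: exp_minus field_simps del: of_nat_Suc)
  then have s: "(\<lambda>k. q ^ k / fact k * exp (- q) * real k) sums q"
    by (subst (asm) sums_Suc_iff) simp
  have "(\<integral>\<^sup>+x. x \<partial>poisson_law r) = (\<integral>\<^sup>+k. of_nat k \<partial>measure_pmf (poisson_pmf q))"
    using False by (simp add: poisson_law_def nn_integral_distr q_def)
  also have "\<dots> = (\<Sum>k. ennreal (pmf (poisson_pmf q) k) * of_nat k)"
    by (simp add: nn_integral_measure_pmf nn_integral_count_space_nat)
  also have "\<dots> = (\<Sum>k. ennreal (q ^ k / fact k * exp (- q) * real k))"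
    using q by (intro suminf_cong) (simp add: ennreal_of_nat_eq_real_of_nat ennreal_mult[symmetric])
  also have "\<dots> = ennreal q"
    using q s by (intro suminf_ennreal_eq) auto
  finally show ?thesis using q by simp
qed

text \<open>Campbell's formula. It is the formula for the mean of a Poisson variable when \<open>f\<close> is an
  indicator, and both sides are additive and continuous along increasing sequences in \<open>f\<close>.\<close>

lemma poisson_process_mean:
  fixes f :: "real \<Rightarrow> ennreal"
  assumes \<xi>: "poisson_process \<Lambda> M \<xi>" and \<Lambda>: "sets \<Lambda> = sets pos_borel"
    and f: "f \<in> borel_measurable pos_borel"
  shows "(\<integral>\<^sup>+\<omega>. (\<integral>\<^sup>+t. f t \<partial>\<xi> \<omega>) \<partial>M) = (\<integral>\<^sup>+t. f t \<partial>\<Lambda>)"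
proof -
  have pp: "point_process M \<xi>" using \<xi> by (simp add: poisson_process_def)
  note lf = point_processD(2)[OF pp]
  have m\<Lambda>: "borel_measurable \<Lambda> = borel_measurable pos_borel"
    using \<Lambda> by (intro measurable_cong_sets) auto
  have sp: "space \<Lambda> = {0<..}"
    using sets_eq_imp_space_eq[OF \<Lambda>] by (simp add: space_restrict_space)
  note meas = measurable_nn_integral_point_process[OF pp]
  show ?thesis using f
  proof (induction rule: borel_measurable_induct)
    case (cong f g)
    have "(\<integral>\<^sup>+t. g t \<partial>\<xi> \<omega>) = (\<integral>\<^sup>+t. f t \<partial>\<xi> \<omega>)" if "\<omega> \<in> space M" for \<omega>
      using lf[OF that] cong(3) by (intro nn_integral_cong) (auto simp: lf_measuresD)
    moreover have "(\<integral>\<^sup>+t. g t \<partial>\<Lambda>) = (\<integral>\<^sup>+t. f t \<partial>\<Lambda>)"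
      using cong(3) sp by (intro nn_integral_cong) auto
    ultimately show ?case using cong(4) by (simp cong: nn_integral_cong)
  next
    case (set A)
    have "(\<integral>\<^sup>+\<omega>. (\<integral>\<^sup>+t. indicator A t \<partial>\<xi> \<omega>) \<partial>M) = (\<integral>\<^sup>+\<omega>. emeasure (\<xi> \<omega>) A \<partial>M)"
      using set lf by (intro nn_integral_cong nn_integral_indicator) (simp add: lf_measuresD)
    also have "\<dots> = (\<integral>\<^sup>+x. x \<partial>distr M borel (\<lambda>\<omega>. emeasure (\<xi> \<omega>) A))"
      using measurable_emeasure_point_process[OF pp set] by (simp add: nn_integral_distr)
    also have "\<dots> = emeasure \<Lambda> A"
      using \<xi> set by (simp add: poisson_process_def nn_integral_poisson_law)
    finally show ?case using set \<Lambda> by simp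
  next
    case (mult u c)
    have "(\<integral>\<^sup>+\<omega>. (\<integral>\<^sup>+t. c * u t \<partial>\<xi> \<omega>) \<partial>M) = (\<integral>\<^sup>+\<omega>. c * (\<integral>\<^sup>+t. u t \<partial>\<xi> \<omega>) \<partial>M)"
      using mult lf by (intro nn_integral_cong nn_integral_cmult) (auto simp: borel_measurable_lf_measure)
    with mult show ?case by (simp add: nn_integral_cmult meas m\<Lambda>)
  next
    case (add u v)
    have "(\<integral>\<^sup>+\<omega>. (\<integral>\<^sup>+t. v t + u t \<partial>\<xi> \<omega>) \<partial>M) = (\<integral>\<^sup>+\<omega>. (\<integral>\<^sup>+t. v t \<partial>\<xi> \<omega>) + (\<integral>\<^sup>+t. u t \<partial>\<xi> \<omega>) \<partial>M)"
      using add lf by (intro nn_integral_cong nn_integral_add) (auto simp: borel_measurable_lf_measure)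
    with add show ?case by (simp add: nn_integral_add meas m\<Lambda>)
  next
    case (seq U)
    have mono: "incseq (\<lambda>i. \<integral>\<^sup>+t. U i t \<partial>\<mu>)" for \<mu>
      using seq(3) by (auto simp: incseq_def le_fun_def intro!: nn_integral_mono)
    have "(\<integral>\<^sup>+\<omega>. (\<integral>\<^sup>+t. (SUP i. U i) t \<partial>\<xi> \<omega>) \<partial>M) = (\<integral>\<^sup>+\<omega>. (SUP i. \<integral>\<^sup>+t. U i t \<partial>\<xi> \<omega>) \<partial>M)"
      using seq lf unfolding SUP_apply
      by (intro nn_integral_cong nn_integral_monotone_convergence_SUP)
         (auto simp: borel_measurable_lf_measure)
    also have "\<dots> = (SUP i. \<integral>\<^sup>+\<omega>. (\<integral>\<^sup>+t. U i t \<partial>\<xi> \<omega>) \<partial>M)"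
      using seq meas mono
      by (intro nn_integral_monotone_convergence_SUP) (auto simp: incseq_def le_fun_def)
    also have "\<dots> = (SUP i. \<integral>\<^sup>+t. U i t \<partial>\<Lambda>)" using seq by simp
    also have "\<dots> = (\<integral>\<^sup>+t. (SUP i. U i) t \<partial>\<Lambda>)"
      using seq unfolding SUP_apply
      by (intro nn_integral_monotone_convergence_SUP[symmetric]) (auto simp: m\<Lambda>)
    finally show ?case .
  qed
qed


section \<open>The law of a Poisson integral\<close>

text \<open>The law of an \<^typ>\<open>ennreal\<close> variable is determined by the probabilities of the events
  \<open>X > a\<close>, and these are continuous along increasing sequences.\<close>

lemma distr_SUP_eqI:
  fixes X :: "nat \<Rightarrow> 'a \<Rightarrow> ennreal" and Y :: "nat \<Rightarrow> 'b \<Rightarrow> ennreal"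
  assumes "prob_space M" "prob_space N"
    and X: "\<And>k. X k \<in> borel_measurable M" "\<And>\<omega>. incseq (\<lambda>k. X k \<omega>)"
    and Y: "\<And>k. Y k \<in> borel_measurable N" "\<And>\<omega>. incseq (\<lambda>k. Y k \<omega>)"
    and eq: "\<And>k. distr M borel (X k) = distr N borel (Y k)"
  shows "distr M borel (\<lambda>\<omega>. SUP k. X k \<omega>) = distr N borel (\<lambda>\<omega>. SUP k. Y k \<omega>)"
proof -
  interpret M: prob_space M by fact
  interpret N: prob_space N by fact
  have mX: "(\<lambda>\<omega>. SUP k. X k \<omega>) \<in> borel_measurable M" using X by measurable
  have mY: "(\<lambda>\<omega>. SUP k. Y k \<omega>) \<in> borel_measurable N" using Y by measurable
  interpret DX: prob_space "distr M borel (\<lambda>\<omega>. SUP k. X k \<omega>)" using mX by (rule M.prob_space_distr)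
  interpret DY: prob_space "distr N borel (\<lambda>\<omega>. SUP k. Y k \<omega>)" using mY by (rule N.prob_space_distr)
  have tail: "emeasure (distr K borel (\<lambda>\<omega>. SUP k. Z k \<omega>)) {a<..} = (SUP k. emeasure (distr K borel (Z k)) {a<..})"
    if Z: "\<And>k. Z k \<in> borel_measurable K" "\<And>\<omega>. incseq (\<lambda>k. Z k \<omega>)"
    for K :: "'e measure" and Z :: "nat \<Rightarrow> 'e \<Rightarrow> ennreal" and a
  proof -
    have mZ: "(\<lambda>\<omega>. SUP k. Z k \<omega>) \<in> borel_measurable K" using Z by measurable
    have "(\<lambda>\<omega>. SUP k. Z k \<omega>) -` {a<..} \<inter> space K = (\<Union>k. Z k -` {a<..} \<inter> space K)"
      by (auto simp: less_SUP_iff)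
    moreover have "emeasure K (\<Union>k. Z k -` {a<..} \<inter> space K) = (SUP k. emeasure K (Z k -` {a<..} \<inter> space K))"
    proof (rule SUP_emeasure_incseq[symmetric])
      show "range (\<lambda>k. Z k -` {a<..} \<inter> space K) \<subseteq> sets K" using Z by (auto intro: measurable_sets)
      show "incseq (\<lambda>k. Z k -` {a<..} \<inter> space K)"
        using Z(2) by (fastforce simp: incseq_def intro: less_le_trans)
    qed
    ultimately show ?thesis using Z mZ by (simp add: emeasure_distr)
  qed
  show ?thesis
  proof (rule measure_eqI_generator_eq_countable)
    \<comment> \<open>No ray \<open>{a<..}\<close> contains \<open>0\<close>, so the rays alone do not cover the space.\<close>
    let ?E = "insert UNIV (range greaterThan) :: ennreal set set"
    have "{a<..} \<inter> {b<..} = {max a b<..}" for a b :: ennreal by auto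
    then show "Int_stable ?E" by (auto simp: Int_stable_def)
    have "sigma_sets UNIV (range greaterThan) = (sigma_sets UNIV ?E :: ennreal set set)"
      by (rule sigma_sets_eqI) (auto intro: sigma_sets_top)
    then have "sets (borel :: ennreal measure) = sigma_sets UNIV ?E"
      by (simp add: borel_Ioi)
    then show "sets (distr M borel (\<lambda>\<omega>. SUP k. X k \<omega>)) = sigma_sets UNIV ?E"
      "sets (distr N borel (\<lambda>\<omega>. SUP k. Y k \<omega>)) = sigma_sets UNIV ?E" by simp_all
    show "emeasure (distr M borel (\<lambda>\<omega>. SUP k. X k \<omega>)) A = emeasure (distr N borel (\<lambda>\<omega>. SUP k. Y k \<omega>)) A"
      if "A \<in> ?E" for A
    proof (cases "A = UNIV")
      case True
      then show ?thesis using DX.emeasure_space_1 DY.emeasure_space_1 by simp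
    next
      case False
      with that obtain a where "A = {a<..}" by auto
      then show ?thesis using X Y eq by (simp add: tail)
    qed
    show "{UNIV} \<subseteq> ?E" by simp
  qed (auto simp: DX.emeasure_space_1)
qed

text \<open>The values of a Poisson process on disjoint sets are independent with prescribed laws, so
  their joint law is the product of these laws and hence determined by the intensity.\<close>

lemma poisson_process_distr_sum:
  fixes A :: "nat \<Rightarrow> real set" and y :: "nat \<Rightarrow> ennreal"
  assumes \<xi>: "poisson_process \<Lambda> M \<xi>" and I: "finite I" "I \<noteq> {}"
    and A: "A ` I \<subseteq> sets pos_borel" "disjoint_family_on A I"
  shows "distr M borel (\<lambda>\<omega>. \<Sum>i\<in>I. y i * emeasure (\<xi> \<omega>) (A i)) =
         distr (\<Pi>\<^sub>M i\<in>I. poisson_law (emeasure \<Lambda> (A i))) borel (\<lambda>x. \<Sum>i\<in>I. y i * x i)"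
proof -
  have pp: "point_process M \<xi>" using \<xi> by (simp add: poisson_process_def)
  interpret prob_space M using point_processD(1)[OF pp] .
  have meas: "(\<lambda>\<omega>. emeasure (\<xi> \<omega>) (A i)) \<in> borel_measurable M" if "i \<in> I" for i
    using measurable_emeasure_point_process[OF pp] A that by auto
  have "indep_vars (\<lambda>_. borel) (\<lambda>i \<omega>. emeasure (\<xi> \<omega>) (A i)) I"
    using \<xi> I A by (simp add: poisson_process_def)
  then have "distr M (\<Pi>\<^sub>M i\<in>I. borel) (\<lambda>\<omega>. \<lambda>i\<in>I. emeasure (\<xi> \<omega>) (A i)) =
      (\<Pi>\<^sub>M i\<in>I. distr M borel (\<lambda>\<omega>. emeasure (\<xi> \<omega>) (A i)))"
    using indep_vars_iff_distr_eq_PiM'[OF I(2), where M' = "\<lambda>_. borel" and X = "\<lambda>i \<omega>. emeasure (\<xi> \<omega>) (A i)"] meas by simp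
  also have "\<dots> = (\<Pi>\<^sub>M i\<in>I. poisson_law (emeasure \<Lambda> (A i)))"
    using \<xi> A by (intro PiM_cong) (auto simp: poisson_process_def)
  finally have joint: "(\<Pi>\<^sub>M i\<in>I. poisson_law (emeasure \<Lambda> (A i))) =
      distr M (\<Pi>\<^sub>M i\<in>I. borel) (\<lambda>\<omega>. \<lambda>i\<in>I. emeasure (\<xi> \<omega>) (A i))" ..
  have vec: "(\<lambda>\<omega>. \<lambda>i\<in>I. emeasure (\<xi> \<omega>) (A i)) \<in> M \<rightarrow>\<^sub>M (\<Pi>\<^sub>M i\<in>I. borel)"
    using meas by (intro measurable_restrict)
  have lin: "(\<lambda>x. \<Sum>i\<in>I. y i * x i) \<in> borel_measurable (\<Pi>\<^sub>M i\<in>I. borel)"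
    by measurable
  show ?thesis unfolding joint distr_distr[OF lin vec]
    by (intro distr_cong) (auto intro!: sum.cong)
qed

text \<open>For a simple integrand the integral is a linear combination of the values on the level
  sets; the general case follows by monotone approximation.\<close>

lemma poisson_process_integral_law_unique:
  fixes f :: "real \<Rightarrow> ennreal"
  assumes \<xi>: "poisson_process \<Lambda> M \<xi>" and \<zeta>: "poisson_process \<Lambda> N \<zeta>"
    and f: "f \<in> borel_measurable pos_borel"
  shows "distr M borel (\<lambda>\<omega>. \<integral>\<^sup>+t. f t \<partial>\<xi> \<omega>) = distr N borel (\<lambda>\<omega>. \<integral>\<^sup>+t. f t \<partial>\<zeta> \<omega>)"
proof -
  have pp: "point_process M \<xi>" "point_process N \<zeta>" using \<xi> \<zeta> by (auto simp: poisson_process_def)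
  have simple: "distr M borel (\<lambda>\<omega>. \<integral>\<^sup>+t. s t \<partial>\<xi> \<omega>) = distr N borel (\<lambda>\<omega>. \<integral>\<^sup>+t. s t \<partial>\<zeta> \<omega>)"
    if s: "simple_function pos_borel s" for s :: "real \<Rightarrow> ennreal"
  proof -
    have fin: "finite (s ` {0<..})" using simple_functionD(1)[OF s] by (simp add: space_restrict_space)
    obtain y where y: "bij_betw y {0..<card (s ` {0<..})} (s ` {0<..})"
      using ex_bij_betw_nat_finite[OF fin] by blast
    define I where "I = {0..<card (s ` {0<..})}"
    define A where "A i = s -` {y i} \<inter> {0<..}" for i
    have I: "finite I" "I \<noteq> {}" using fin by (auto simp: I_def card_gt_0_iff)
    have A1: "A ` I \<subseteq> sets pos_borel"
      using simple_functionD(2)[OF s] by (auto simp: A_def space_restrict_space)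
    have A2: "disjoint_family_on A I"
      using bij_betw_imp_inj_on[OF y] by (auto simp: disjoint_family_on_def A_def I_def inj_on_def)
    have rep: "(\<integral>\<^sup>+t. s t \<partial>\<mu>) = (\<Sum>i\<in>I. y i * emeasure \<mu> (A i))" if \<mu>: "\<mu> \<in> lf_measures" for \<mu>
    proof -
      have "simple_function \<mu> s" using s lf_measuresD[OF \<mu>]
        by (simp add: simple_function_def space_restrict_space)
      then have "(\<integral>\<^sup>+t. s t \<partial>\<mu>) = (\<Sum>x\<in>s ` {0<..}. x * emeasure \<mu> (s -` {x} \<inter> {0<..}))"
        using lf_measuresD[OF \<mu>] by (simp add: nn_integral_eq_simple_integral simple_integral_def)
      also have "\<dots> = (\<Sum>i\<in>I. y i * emeasure \<mu> (A i))"
        unfolding A_def I_def by (rule sum.reindex_bij_betw[OF y, symmetric])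
      finally show ?thesis .
    qed
    have "distr M borel (\<lambda>\<omega>. \<integral>\<^sup>+t. s t \<partial>\<xi> \<omega>) = distr M borel (\<lambda>\<omega>. \<Sum>i\<in>I. y i * emeasure (\<xi> \<omega>) (A i))"
      "distr N borel (\<lambda>\<omega>. \<integral>\<^sup>+t. s t \<partial>\<zeta> \<omega>) = distr N borel (\<lambda>\<omega>. \<Sum>i\<in>I. y i * emeasure (\<zeta> \<omega>) (A i))"
      using point_processD(2)[OF pp(1)] point_processD(2)[OF pp(2)] by (auto intro!: distr_cong rep)
    then show ?thesis
      by (simp add: poisson_process_distr_sum[OF \<xi> I A1 A2] poisson_process_distr_sum[OF \<zeta> I A1 A2])
  qed
  obtain s where s: "\<And>i. simple_function pos_borel (s i)" "incseq s" "\<And>x. (SUP i. s i x) = f x"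
    using borel_measurable_implies_simple_function_sequence'[OF f] by metis
  have ms: "s i \<in> borel_measurable pos_borel" for i
    using s(1) by (rule borel_measurable_simple_function)
  have mono: "incseq (\<lambda>i. \<integral>\<^sup>+t. s i t \<partial>\<mu>)" for \<mu>
    using s(2) by (auto simp: incseq_def le_fun_def intro!: nn_integral_mono)
  have lim: "(\<integral>\<^sup>+t. f t \<partial>\<mu>) = (SUP i. \<integral>\<^sup>+t. s i t \<partial>\<mu>)" if "\<mu> \<in> lf_measures" for \<mu>
    using that s ms unfolding s(3)[symmetric]
    by (intro nn_integral_monotone_convergence_SUP) (auto simp: borel_measurable_lf_measure)
  have "distr M borel (\<lambda>\<omega>. \<integral>\<^sup>+t. f t \<partial>\<xi> \<omega>) = distr M borel (\<lambda>\<omega>. SUP i. \<integral>\<^sup>+t. s i t \<partial>\<xi> \<omega>)"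
    "distr N borel (\<lambda>\<omega>. \<integral>\<^sup>+t. f t \<partial>\<zeta> \<omega>) = distr N borel (\<lambda>\<omega>. SUP i. \<integral>\<^sup>+t. s i t \<partial>\<zeta> \<omega>)"
    using point_processD(2)[OF pp(1)] point_processD(2)[OF pp(2)] by (auto intro!: distr_cong lim)
  moreover have "distr M borel (\<lambda>\<omega>. SUP i. \<integral>\<^sup>+t. s i t \<partial>\<xi> \<omega>) = distr N borel (\<lambda>\<omega>. SUP i. \<integral>\<^sup>+t. s i t \<partial>\<zeta> \<omega>)"
    using simple[OF s(1)] mono pp[THEN point_processD(1)]
      measurable_nn_integral_point_process[OF pp(1) ms] measurable_nn_integral_point_process[OF pp(2) ms]
    by (intro distr_SUP_eqI) auto
  ultimately show ?thesis by simp
qed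


section \<open>Bounded continuous functions of vague integrals\<close>

text \<open>The order interval \<open>[0, \<infinity>]\<close> is compact, so a continuous function on it is uniformly
  continuous. The additive form of closeness used here makes two infinite values close to each
  other, but an infinite one never close to a finite one.\<close>

lemma continuous_ennreal_uniform:
  fixes F :: "ennreal \<Rightarrow> real"
  assumes F: "continuous_on UNIV F" and e: "e > 0"
  obtains d :: real where "d > 0"
    "\<And>x y. x \<le> y + ennreal d \<Longrightarrow> y \<le> x + ennreal d \<Longrightarrow> \<bar>F x - F y\<bar> < e"
proof -
  have "\<exists>d>0. \<forall>x y. x \<le> y + ennreal d \<longrightarrow> y \<le> x + ennreal d \<longrightarrow> \<bar>F x - F y\<bar> < e"
  proof (rule ccontr)
    assume "\<not> ?thesis"
    then have "\<forall>n. \<exists>x y. x \<le> y + ennreal (inverse (real (Suc n))) \<and>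
        y \<le> x + ennreal (inverse (real (Suc n))) \<and> \<not> \<bar>F x - F y\<bar> < e"
      by (meson inverse_positive_iff_positive of_nat_0_less_iff zero_less_Suc)
    then obtain X Y where
      XY: "\<And>n. X n \<le> Y n + ennreal (inverse (real (Suc n)))"
          "\<And>n. Y n \<le> X n + ennreal (inverse (real (Suc n)))" "\<And>n. e \<le> \<bar>F (X n) - F (Y n)\<bar>"
      by (metis not_less)
    obtain l r where r: "strict_mono r" "(X \<circ> r) \<longlonglongrightarrow> l"
      using compact_complete_linorder by blast
    obtain m s where s: "strict_mono s" "((Y \<circ> r) \<circ> s) \<longlonglongrightarrow> m"
      using compact_complete_linorder by blast
    define q where "q = r \<circ> s"
    have q: "strict_mono q" using r s by (simp add: q_def strict_mono_o)
    have X: "(\<lambda>n. X (q n)) \<longlonglongrightarrow> l"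
      using LIMSEQ_subseq_LIMSEQ[OF r(2) s(1)] by (simp add: q_def o_def)
    have Y: "(\<lambda>n. Y (q n)) \<longlonglongrightarrow> m" using s by (simp add: q_def o_def)
    have "(\<lambda>n. ennreal (inverse (real (Suc n)))) \<longlonglongrightarrow> ennreal 0"
      using LIMSEQ_inverse_real_of_nat by (intro tendsto_ennrealI)
    from LIMSEQ_subseq_LIMSEQ[OF this q]
    have d: "(\<lambda>n. ennreal (inverse (real (Suc (q n))))) \<longlonglongrightarrow> 0" by (simp add: o_def)
    have "l \<le> m + 0" using XY(1) by (intro LIMSEQ_le[OF X tendsto_add[OF Y d]]) auto
    moreover have "m \<le> l + 0" using XY(2) by (intro LIMSEQ_le[OF Y tendsto_add[OF X d]]) auto
    ultimately have "l = m" by simp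
    have "isCont F x" for x using F by (simp add: continuous_on_eq_continuous_at)
    then have "(\<lambda>n. \<bar>F (X (q n)) - F (Y (q n))\<bar>) \<longlonglongrightarrow> \<bar>F l - F m\<bar>"
      using X Y by (intro tendsto_rabs tendsto_diff isCont_tendsto_compose[of _ F])
    then have "e \<le> \<bar>F l - F m\<bar>" using XY(3) by (intro LIMSEQ_le_const) auto
    with \<open>l = m\<close> e show False by simp
  qed
  then show ?thesis using that by blast
qed

lemma vague_test_function_nn_integral:
  assumes \<mu>: "\<mu> \<in> lf_measures" and f: "f \<in> vague_test_functions"
  shows "(\<integral>\<^sup>+t. ennreal (f t) \<partial>\<mu>) = ennreal (\<integral>t. f t \<partial>\<mu>)"
proof (rule nn_integral_eq_integral)
  note [simp] = lf_measuresD[OF \<mu>] borel_measurable_lf_measure[OF \<mu>]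
  obtain K where K: "compact K" "K \<subseteq> {0<..}" "\<forall>t\<in>{0<..} - K. f t = 0"
    using f by (auto simp: vague_test_functions_def)
  have "bounded (f ` {0<..})" using f by (simp add: vague_test_functions_def)
  then obtain B where B: "\<And>t. t > 0 \<Longrightarrow> norm (f t) \<le> B"
    unfolding bounded_iff by auto
  show "AE t in \<mu>. 0 \<le> f t"
    using f by (intro AE_I2) (simp add: vague_test_functions_def)
  show "integrable \<mu> f"
  proof (rule integrableI_bounded_set)
    show "K \<in> sets \<mu>" using K by (auto simp: sets_restrict_space image_iff intro!: bexI[of _ K] borel_compact)
    show "f \<in> borel_measurable \<mu>"
      using f by (simp add: vague_test_functions_def borel_measurable_continuous_on_restrict)
    show "emeasure \<mu> K < \<infinity>" using \<mu> K by (simp add: lf_measures_def)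
    show "AE x\<in>K in \<mu>. norm (f x) \<le> B" using B by (intro AE_I2) simp
    show "AE x in \<mu>. x \<notin> K \<longrightarrow> f x = 0" using K by (intro AE_I2) simp
  qed
qed

lemma continuous_map_vague_integral:
  assumes "f \<in> vague_test_functions"
  shows "continuous_map vague_topology euclidean (\<lambda>\<mu>. integral\<^sup>L \<mu> f)"
  unfolding continuous_map
proof (intro conjI allI impI)
  fix U :: "real set" assume "openin euclidean U"
  then have "{\<mu> \<in> lf_measures. integral\<^sup>L \<mu> f \<in> U} \<in>
      {{\<mu> \<in> lf_measures. integral\<^sup>L \<mu> f \<in> U} | f U. f \<in> vague_test_functions \<and> open U}"
    using assms by auto
  then show "openin vague_topology {\<mu> \<in> topspace vague_topology. integral\<^sup>L \<mu> f \<in> U}"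
    unfolding topspace_vague_topology unfolding vague_topology_def by (rule topology_generated_by_Basis)
qed auto

text \<open>On vague test functions, the map \<open>\<mu> \<mapsto> G (\<integral>f d\<mu>)\<close> is itself bounded and continuous for the vague
  topology, hence an admissible test for convergence of the processes.\<close>

lemma conv_in_distribution_vague_integral:
  fixes G :: "ennreal \<Rightarrow> real"
  assumes conv: "conv_in_distribution vague_topology M \<nu> N \<eta>"
    and \<nu>: "\<And>n. point_process (M n) (\<nu> n)" and \<eta>: "point_process N \<eta>"
    and f: "f \<in> vague_test_functions"
    and G: "continuous_on UNIV G" "bounded (range G)"
  shows "(\<lambda>n. \<integral>\<omega>. G (\<integral>\<^sup>+t. ennreal (f t) \<partial>\<nu> n \<omega>) \<partial>M n) \<longlonglongrightarrow> (\<integral>\<omega>. G (\<integral>\<^sup>+t. ennreal (f t) \<partial>\<eta> \<omega>) \<partial>N)"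
proof -
  have "continuous_map vague_topology euclidean (\<lambda>\<mu>. G (ennreal (integral\<^sup>L \<mu> f)))"
  proof -
    have "continuous_on UNIV (\<lambda>x. G (ennreal x))"
      by (intro continuous_on_compose2[OF G(1)] continuous_on_ennreal continuous_on_id) auto
    then have "continuous_map euclidean euclidean (\<lambda>x. G (ennreal x))" by simp
    from continuous_map_compose[OF continuous_map_vague_integral[OF f] this]
    show ?thesis by (simp add: o_def)
  qed
  moreover have "bounded ((\<lambda>\<mu>. G (ennreal (integral\<^sup>L \<mu> f))) ` topspace vague_topology)"
    by (rule bounded_subset[OF G(2)]) auto
  ultimately have "(\<lambda>n. \<integral>\<omega>. G (ennreal (integral\<^sup>L (\<nu> n \<omega>) f)) \<partial>M n) \<longlonglongrightarrow>
      (\<integral>\<omega>. G (ennreal (integral\<^sup>L (\<eta> \<omega>) f)) \<partial>N)"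
    using conv[unfolded conv_in_distribution_def, rule_format, of "\<lambda>\<mu>. G (ennreal (integral\<^sup>L \<mu> f))"]
    by blast
  moreover have "(\<integral>\<omega>. G (ennreal (integral\<^sup>L (\<nu> n \<omega>) f)) \<partial>M n) = (\<integral>\<omega>. G (\<integral>\<^sup>+t. ennreal (f t) \<partial>\<nu> n \<omega>) \<partial>M n)" for n
    using point_processD(2)[OF \<nu>] f
    by (intro Bochner_Integration.integral_cong) (auto simp: vague_test_function_nn_integral)
  moreover have "(\<integral>\<omega>. G (ennreal (integral\<^sup>L (\<eta> \<omega>) f)) \<partial>N) = (\<integral>\<omega>. G (\<integral>\<^sup>+t. ennreal (f t) \<partial>\<eta> \<omega>) \<partial>N)"
    using point_processD(2)[OF \<eta>] f
    by (intro Bochner_Integration.integral_cong) (auto simp: vague_test_function_nn_integral)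
  ultimately show ?thesis by simp
qed

section \<open>Continuous truncation of the integrand\<close>

definition trapezoid :: "real \<Rightarrow> real \<Rightarrow> real \<Rightarrow> real \<Rightarrow> real \<Rightarrow> real" where
  "trapezoid a b c d t = max 0 (min 1 (min ((t - a) / (b - a)) ((d - t) / (d - c))))"

lemma trapezoid_nonneg: "0 \<le> trapezoid a b c d t"
  and trapezoid_le_1: "trapezoid a b c d t \<le> 1"
  by (auto simp: trapezoid_def)

lemma trapezoid_eq_1: "a < b \<Longrightarrow> c < d \<Longrightarrow> b \<le> t \<Longrightarrow> t \<le> c \<Longrightarrow> trapezoid a b c d t = 1"
  by (auto simp: trapezoid_def field_simps min_def)

lemma trapezoid_eq_0:
  assumes "a < b" "c < d" "t \<le> a \<or> d \<le> t"
  shows "trapezoid a b c d t = 0"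
proof -
  have "(t - a) / (b - a) \<le> 0 \<or> (d - t) / (d - c) \<le> 0"
    using assms by (auto intro: divide_nonpos_pos)
  then show ?thesis by (auto simp: trapezoid_def max_def)
qed

lemma continuous_on_trapezoid: "a < b \<Longrightarrow> c < d \<Longrightarrow> continuous_on A (trapezoid a b c d)"
  unfolding trapezoid_def by (intro continuous_intros) auto

lemma mult_trapezoid_vague_test_function:
  assumes abcd: "0 < a" "a < b" "c < d" and g: "continuous_on UNIV g" "\<And>t. t > 0 \<Longrightarrow> 0 \<le> g t"
  shows "(\<lambda>t. g t * trapezoid a b c d t) \<in> vague_test_functions"
proof -
  let ?f = "\<lambda>t. g t * trapezoid a b c d t"
  have cont: "continuous_on A ?f" for A
    using abcd by (intro continuous_intros continuous_on_trapezoid continuous_on_subset[OF g(1)]) auto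
  have zero: "?f t = 0" if "t \<notin> {a..d}" for t
    using that abcd trapezoid_eq_0[of a b c d t] by auto
  have "compact (?f ` {a..d})" using cont by (intro compact_continuous_image) auto
  then have "bounded (insert 0 (?f ` {a..d}))" by (simp add: compact_imp_bounded)
  then have "bounded (?f ` {0<..})" by (rule bounded_subset) (use zero in blast)
  moreover have "\<exists>K. compact K \<and> K \<subseteq> {0<..} \<and> (\<forall>t\<in>{0<..} - K. ?f t = 0)"
    using zero abcd by (intro exI[of _ "{a..d}"]) auto
  ultimately show ?thesis
    using cont g(2) trapezoid_nonneg[of a b c d] by (simp add: vague_test_functions_def)
qed

text \<open>The vague topology only sees continuous integrands with compact support in \<open>(0, \<infinity>)\<close>; this is
  one that agrees with \<open>t\<close> on \<open>[\<epsilon>, 1]\<close> and lies below \<open>t\<close> on \<open>(0, 1]\<close>.\<close>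

definition truncated_identity :: "real \<Rightarrow> real \<Rightarrow> real" where
  "truncated_identity \<epsilon> t = t * trapezoid (\<epsilon> / 2) \<epsilon> 1 (1 + \<epsilon>) t"

text \<open>A continuous majorant of the indicator of the interval in which \<^const>\<open>truncated_identity\<close>
  overshoots; its integral against the intensity is of order \<open>\<epsilon>\<close> as \<open>\<epsilon>\<close> tends to \<open>0\<close>.\<close>

definition overshoot :: "real \<Rightarrow> real \<Rightarrow> real" where
  "overshoot \<epsilon> = trapezoid (1 - \<epsilon>) 1 (1 + \<epsilon>) (1 + 2 * \<epsilon>)"

lemma truncated_identity_test: "0 < \<epsilon> \<Longrightarrow> truncated_identity \<epsilon> \<in> vague_test_functions"
  unfolding truncated_identity_def by (rule mult_trapezoid_vague_test_function) auto

lemma overshoot_test: "0 < \<epsilon> \<Longrightarrow> \<epsilon> < 1 \<Longrightarrow> overshoot \<epsilon> \<in> vague_test_functions"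
  using mult_trapezoid_vague_test_function[of "1 - \<epsilon>" 1 "1 + \<epsilon>" "1 + 2 * \<epsilon>" "\<lambda>_. 1"]
  by (simp add: overshoot_def cong: if_cong)

lemma vague_test_function_measurable:
  "f \<in> vague_test_functions \<Longrightarrow> (\<lambda>t. ennreal (f t)) \<in> borel_measurable pos_borel"
  by (rule measurable_compose[OF borel_measurable_continuous_on_restrict measurable_ennreal])
     (simp add: vague_test_functions_def)

lemma identity_on_measurable:
  assumes [measurable]: "A \<in> sets borel"
  shows "(\<lambda>t::real. ennreal t * indicator A t) \<in> borel_measurable pos_borel"
  by (intro measurable_restrict_space1) measurable

lemma less_one_ennreal_of_nat: "(of_nat k :: ennreal) < 1 \<longleftrightarrow> k = 0"
  using of_nat_less_iff[of k 1, where 'a = ennreal] by (cases k) auto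

text \<open>For a counting measure, having mass less than one on an interval means having no point in it.
  So outside the two exceptional events \<open>R \<ge> d\<close> and \<open>H \<ge> 1\<close>, the truncated
  integral \<open>T\<close> gains nothing beyond \<open>1\<close> and loses at most \<open>R\<close> near \<open>0\<close>, and \<open>F\<close> moves by at
  most \<open>e\<close>; on the exceptional events the last two terms on the right dominate the trivial
  bound \<open>2 * B\<close>.\<close>

lemma truncation_error:
  fixes F :: "ennreal \<Rightarrow> real"
  assumes \<mu>: "\<mu> \<in> lf_measures"
    and int: "\<And>A. A \<in> sets pos_borel \<Longrightarrow> emeasure \<mu> A \<in> insert \<infinity> (range of_nat)"
    and \<epsilon>: "0 < \<epsilon>" "\<epsilon> < 1" and d: "d > 0" and e: "e > 0"
    and B: "\<And>x. \<bar>F x\<bar> \<le> B"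
    and unif: "\<And>x y. x \<le> y + ennreal d \<Longrightarrow> y \<le> x + ennreal d \<Longrightarrow> \<bar>F x - F y\<bar> < e"
  defines "S \<equiv> \<integral>\<^sup>+t\<in>{0<..1}. ennreal t \<partial>\<mu>" and "R \<equiv> \<integral>\<^sup>+t\<in>{0<..\<epsilon>}. ennreal t \<partial>\<mu>"
    and "T \<equiv> \<integral>\<^sup>+t. ennreal (truncated_identity \<epsilon> t) \<partial>\<mu>" and "H \<equiv> \<integral>\<^sup>+t. ennreal (overshoot \<epsilon> t) \<partial>\<mu>"
  shows "ennreal \<bar>F S - F T\<bar> \<le> ennreal e + ennreal (2 * B / d) * R + ennreal (2 * B) * min 1 H"
proof -
  note [simp] = lf_measuresD[OF \<mu>] borel_measurable_lf_measure[OF \<mu>]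
  have B0: "0 \<le> B" using B[of 0] by linarith
  have triv: "\<bar>F S - F T\<bar> \<le> 2 * B" using B[of S] B[of T] by linarith
  consider "R \<ge> ennreal d" | "H \<ge> 1" | "R < ennreal d" "H < 1" by (meson not_le)
  then show ?thesis
  proof cases
    case 1
    have "ennreal \<bar>F S - F T\<bar> \<le> ennreal (2 * B)" using triv by (rule ennreal_leI)
    also have "\<dots> = ennreal (2 * B / d) * ennreal d"
      using d B0 by (subst ennreal_mult[symmetric]) auto
    also have "\<dots> \<le> ennreal (2 * B / d) * R" using 1 by (intro mult_left_mono) auto
    also have "\<dots> \<le> ennreal e + ennreal (2 * B / d) * R + ennreal (2 * B) * min 1 H"
      by (simp add: add.assoc add_increasing add_increasing2)
    finally show ?thesis .
  next
    case 2
    have "ennreal \<bar>F S - F T\<bar> \<le> ennreal (2 * B)" using triv by (rule ennreal_leI)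
    also have "\<dots> = ennreal (2 * B) * min 1 H" using 2 by (simp add: min_absorb1)
    also have "\<dots> \<le> ennreal e + ennreal (2 * B / d) * R + ennreal (2 * B) * min 1 H"
      by (simp add: add_increasing)
    finally show ?thesis .
  next
    case 3
    let ?A = "{1<..<1 + \<epsilon>}"
    have A: "?A \<in> sets pos_borel" using \<epsilon> by (auto simp: sets_restrict_space image_iff intro!: bexI[of _ ?A])
    have "emeasure \<mu> ?A = (\<integral>\<^sup>+t. indicator ?A t \<partial>\<mu>)" using A by simp
    also have "\<dots> \<le> H" unfolding H_def
      using \<epsilon> by (intro nn_integral_mono) (auto simp: overshoot_def trapezoid_eq_1 split: split_indicator)
    finally have "emeasure \<mu> ?A < 1" using 3 by simp
    moreover have "emeasure \<mu> ?A = \<infinity> \<or> (\<exists>k. emeasure \<mu> ?A = of_nat k)" using int[OF A] by blast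
    ultimately have "emeasure \<mu> ?A = 0" by (auto simp: less_one_ennreal_of_nat)
    then have "?A \<in> null_sets \<mu>" using A by auto
    then have "AE t in \<mu>. t \<notin> ?A" by (rule AE_not_in)
    then have "AE t in \<mu>. ennreal (truncated_identity \<epsilon> t) \<le> ennreal t * indicator {0<..1} t"
    proof (rule AE_mp, intro AE_I2 impI)
      fix t assume t: "t \<in> space \<mu>" "t \<notin> ?A"
      then have "0 < t" by simp
      have "truncated_identity \<epsilon> t \<le> t"
        using \<open>0 < t\<close> trapezoid_le_1 by (simp add: truncated_identity_def mult_left_le)
      moreover have "truncated_identity \<epsilon> t = 0" if "t > 1"
        using that t \<epsilon> by (simp add: truncated_identity_def trapezoid_eq_0)
      ultimately show "ennreal (truncated_identity \<epsilon> t) \<le> ennreal t * indicator {0<..1} t"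
        using \<open>0 < t\<close> by (auto simp: ennreal_leI split: split_indicator)
    qed
    then have "T \<le> S" unfolding T_def S_def by (rule nn_integral_mono_AE)
    have "S \<le> (\<integral>\<^sup>+t. ennreal (truncated_identity \<epsilon> t) + ennreal t * indicator {0<..\<epsilon>} t \<partial>\<mu>)"
      unfolding S_def using \<epsilon>
      by (intro nn_integral_mono) (auto simp: truncated_identity_def trapezoid_eq_1 split: split_indicator)
    also have "\<dots> = T + R" unfolding T_def R_def
      using \<epsilon> by (intro nn_integral_add)
        (auto intro!: vague_test_function_measurable truncated_identity_test identity_on_measurable)
    also have "\<dots> \<le> T + ennreal d" using 3 by (intro add_left_mono) simp
    finally have "\<bar>F S - F T\<bar> < e" using \<open>T \<le> S\<close> by (intro unif) (auto intro: add_increasing2)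
    then have "ennreal \<bar>F S - F T\<bar> \<le> ennreal e" by (intro ennreal_leI) simp
    also have "\<dots> \<le> ennreal e + ennreal (2 * B / d) * R + ennreal (2 * B) * min 1 H"
      by (simp add: add.assoc)
    finally show ?thesis .
  qed
qed

lemma expected_truncation_error:
  fixes F :: "ennreal \<Rightarrow> real" and \<xi> :: "'a \<Rightarrow> real measure"
  assumes pp: "point_process M \<xi>" and F: "continuous_on UNIV F"
    and \<epsilon>: "0 < \<epsilon>" "\<epsilon> < 1" and d: "d > 0" and e: "e > 0"
    and B: "\<And>x. \<bar>F x\<bar> \<le> B"
    and unif: "\<And>x y. x \<le> y + ennreal d \<Longrightarrow> y \<le> x + ennreal d \<Longrightarrow> \<bar>F x - F y\<bar> < e"
  shows "ennreal \<bar>(\<integral>\<omega>. F (\<integral>\<^sup>+t\<in>{0<..1}. ennreal t \<partial>\<xi> \<omega>) \<partial>M)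
                    - (\<integral>\<omega>. F (\<integral>\<^sup>+t. ennreal (truncated_identity \<epsilon> t) \<partial>\<xi> \<omega>) \<partial>M)\<bar> \<le>
    ennreal e + ennreal (2 * B / d) * (\<integral>\<^sup>+\<omega>. (\<integral>\<^sup>+t\<in>{0<..\<epsilon>}. ennreal t \<partial>\<xi> \<omega>) \<partial>M)
      + ennreal (2 * B) * (\<integral>\<^sup>+\<omega>. min 1 (\<integral>\<^sup>+t. ennreal (overshoot \<epsilon> t) \<partial>\<xi> \<omega>) \<partial>M)"
proof -
  interpret prob_space M using point_processD(1)[OF pp] .
  let ?S = "\<lambda>\<omega>. \<integral>\<^sup>+t\<in>{0<..1}. ennreal t \<partial>\<xi> \<omega>" and ?R = "\<lambda>\<omega>. \<integral>\<^sup>+t\<in>{0<..\<epsilon>}. ennreal t \<partial>\<xi> \<omega>"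
  let ?T = "\<lambda>\<omega>. \<integral>\<^sup>+t. ennreal (truncated_identity \<epsilon> t) \<partial>\<xi> \<omega>"
  let ?H = "\<lambda>\<omega>. \<integral>\<^sup>+t. ennreal (overshoot \<epsilon> t) \<partial>\<xi> \<omega>"
  note meas = measurable_nn_integral_point_process[OF pp]
  have [measurable]: "?S \<in> borel_measurable M" "?R \<in> borel_measurable M"
    by (intro meas identity_on_measurable; simp)+
  have [measurable]: "?T \<in> borel_measurable M" "?H \<in> borel_measurable M"
    using \<epsilon> by (intro meas vague_test_function_measurable truncated_identity_test overshoot_test; simp)+
  have [measurable]: "F \<in> borel_measurable borel" using F by (rule borel_measurable_continuous_onI)
  have int: "integrable M (\<lambda>\<omega>. F (?S \<omega>))" "integrable M (\<lambda>\<omega>. F (?T \<omega>))"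
    using B by (auto intro!: integrable_const_bound[of _ B])
  have "ennreal \<bar>(\<integral>\<omega>. F (?S \<omega>) \<partial>M) - (\<integral>\<omega>. F (?T \<omega>) \<partial>M)\<bar> = ennreal (norm (\<integral>\<omega>. F (?S \<omega>) - F (?T \<omega>) \<partial>M))"
    using int by simp
  also have "\<dots> \<le> (\<integral>\<^sup>+\<omega>. ennreal (norm (F (?S \<omega>) - F (?T \<omega>))) \<partial>M)"
    using int by (intro integral_norm_bound_ennreal) auto
  also have "\<dots> \<le> (\<integral>\<^sup>+\<omega>. ennreal e + ennreal (2 * B / d) * ?R \<omega> + ennreal (2 * B) * min 1 (?H \<omega>) \<partial>M)"
  proof (intro nn_integral_mono)
    fix \<omega> assume \<omega>: "\<omega> \<in> space M"
    have "emeasure (\<xi> \<omega>) A \<in> insert \<infinity> (range of_nat)" if "A \<in> sets pos_borel" for A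
      using pp \<omega> that unfolding point_process_def by blast
    from truncation_error[OF point_processD(2)[OF pp \<omega>] this \<epsilon> d e B unif]
    show "ennreal (norm (F (?S \<omega>) - F (?T \<omega>))) \<le>
        ennreal e + ennreal (2 * B / d) * ?R \<omega> + ennreal (2 * B) * min 1 (?H \<omega>)" by simp
  qed
  also have "\<dots> = ennreal e + ennreal (2 * B / d) * (\<integral>\<^sup>+\<omega>. ?R \<omega> \<partial>M)
      + ennreal (2 * B) * (\<integral>\<^sup>+\<omega>. min 1 (?H \<omega>) \<partial>M)"
    by (simp add: nn_integral_add nn_integral_cmult emeasure_space_1)
  finally show ?thesis .
qed


section \<open>The Dickman intensity\<close>

lemma sets_dickman_intensity: "sets (dickman_intensity c) = sets pos_borel"
  by (simp add: dickman_intensity_def sets_restrict_space)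

lemma nn_integral_dickman_intensity:
  assumes f: "f \<in> borel_measurable pos_borel"
  shows "(\<integral>\<^sup>+t. f t \<partial>dickman_intensity c) = (\<integral>\<^sup>+t. ennreal (c / t) * f t * indicator {0<..} t \<partial>lborel)"
proof -
  have m: "borel_measurable (restrict_space lborel {0<..}) = borel_measurable pos_borel"
    by (intro measurable_cong_sets) (auto simp: sets_restrict_space)
  have "(\<lambda>t. ennreal (c / t)) \<in> borel_measurable pos_borel"
    by (intro measurable_restrict_space1) measurable
  then have "(\<integral>\<^sup>+t. f t \<partial>dickman_intensity c) = (\<integral>\<^sup>+t. ennreal (c / t) * f t \<partial>restrict_space lborel {0<..})"
    unfolding dickman_intensity_def using f by (intro nn_integral_density) (auto simp: m)
  also have "\<dots> = (\<integral>\<^sup>+t. ennreal (c / t) * f t * indicator {0<..} t \<partial>lborel)"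
    by (rule nn_integral_restrict_space) simp
  finally show ?thesis .
qed

lemma dickman_mean_near_0:
  assumes \<eta>: "poisson_process (dickman_intensity c) N \<eta>" and "c > 0" "\<epsilon> \<ge> 0"
  shows "(\<integral>\<^sup>+\<omega>. (\<integral>\<^sup>+t\<in>{0<..\<epsilon>}. ennreal t \<partial>\<eta> \<omega>) \<partial>N) = ennreal (c * \<epsilon>)"
proof -
  have "(\<integral>\<^sup>+\<omega>. (\<integral>\<^sup>+t\<in>{0<..\<epsilon>}. ennreal t \<partial>\<eta> \<omega>) \<partial>N) =
      (\<integral>\<^sup>+t. ennreal (c / t) * (ennreal t * indicator {0<..\<epsilon>} t) * indicator {0<..} t \<partial>lborel)"
    by (simp add: poisson_process_mean[OF \<eta> sets_dickman_intensity] identity_on_measurable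
        nn_integral_dickman_intensity)
  also have "\<dots> = (\<integral>\<^sup>+t. ennreal c * indicator {0<..\<epsilon>} t \<partial>lborel)"
    using \<open>c > 0\<close> by (intro nn_integral_cong) (auto simp: ennreal_mult[symmetric] split: split_indicator)
  also have "\<dots> = ennreal (c * \<epsilon>)"
    using \<open>\<epsilon> \<ge> 0\<close> \<open>c > 0\<close> by (simp add: nn_integral_cmult_indicator ennreal_mult)
  finally show ?thesis .
qed

text \<open>The support of \<^const>\<open>overshoot\<close> has length \<open>3 * \<epsilon>\<close> and stays to the right of \<open>1 / 2\<close>, where the
  density \<open>c / t\<close> is at most \<open>2 * c\<close>.\<close>

lemma dickman_mean_overshoot:
  assumes \<eta>: "poisson_process (dickman_intensity c) N \<eta>" and "c > 0" and \<epsilon>: "0 < \<epsilon>" "\<epsilon> \<le> 1 / 2"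
  shows "(\<integral>\<^sup>+\<omega>. (\<integral>\<^sup>+t. ennreal (overshoot \<epsilon> t) \<partial>\<eta> \<omega>) \<partial>N) \<le> ennreal (6 * c * \<epsilon>)"
proof -
  let ?J = "{1 - \<epsilon>..1 + 2 * \<epsilon>}"
  have meas: "(\<lambda>t. ennreal (overshoot \<epsilon> t)) \<in> borel_measurable pos_borel"
    using \<epsilon> by (intro vague_test_function_measurable overshoot_test) auto
  have "(\<integral>\<^sup>+\<omega>. (\<integral>\<^sup>+t. ennreal (overshoot \<epsilon> t) \<partial>\<eta> \<omega>) \<partial>N) =
      (\<integral>\<^sup>+t. ennreal (c / t) * ennreal (overshoot \<epsilon> t) * indicator {0<..} t \<partial>lborel)"
    using meas by (simp add: poisson_process_mean[OF \<eta> sets_dickman_intensity]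
        nn_integral_dickman_intensity)
  also have "\<dots> \<le> (\<integral>\<^sup>+t. ennreal (2 * c) * indicator ?J t \<partial>lborel)"
  proof (intro nn_integral_mono)
    fix t :: real
    show "ennreal (c / t) * ennreal (overshoot \<epsilon> t) * indicator {0<..} t \<le> ennreal (2 * c) * indicator ?J t"
    proof (cases "t \<in> ?J")
      case True
      then have t: "1 / 2 \<le> t" using \<epsilon> by simp
      have "c \<le> 2 * c * t" using mult_left_mono[OF t, of "2 * c"] \<open>c > 0\<close> by simp
      then have "c / t \<le> 2 * c" using t by (simp add: divide_le_eq)
      then have "ennreal (c / t) * ennreal (overshoot \<epsilon> t) \<le> ennreal (2 * c) * 1"
        using trapezoid_le_1 by (intro mult_mono ennreal_leI) (auto simp: overshoot_def)
      then show ?thesis using True t by simp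
    next
      case False
      then show ?thesis using \<epsilon> by (auto simp: overshoot_def trapezoid_eq_0)
    qed
  qed
  also have "\<dots> = ennreal (6 * c * \<epsilon>)"
    using \<epsilon> \<open>c > 0\<close> by (simp add: nn_integral_cmult_indicator ennreal_mult[symmetric] field_simps)
  finally show ?thesis .
qed

text \<open>The law of the sum of the points in \<open>(0, 1)\<close> does not depend on the Poisson process, this sum
  is almost surely finite because its mean is \<open>c\<close>, and almost surely there is no point at \<open>1\<close>.\<close>

lemma dickman_law:
  fixes \<eta> :: "'b \<Rightarrow> real measure" and D :: "'d \<Rightarrow> real"
  assumes "c > 0" and \<eta>: "poisson_process (dickman_intensity c) N \<eta>" and D: "gen_dickman c P D"
  shows "distr N borel (\<lambda>\<omega>. \<integral>\<^sup>+t\<in>{0<..1}. ennreal t \<partial>\<eta> \<omega>) = distr P borel (\<lambda>x. ennreal (D x))"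
proof -
  obtain Q :: "real measure" and \<zeta> where \<zeta>: "poisson_process (dickman_intensity c) Q \<zeta>"
    and law: "distr P borel D = distr Q borel (\<lambda>\<omega>. enn2real (\<integral>\<^sup>+t\<in>{0<..<1}. ennreal t \<partial>\<zeta> \<omega>))"
    and [measurable]: "D \<in> borel_measurable P"
    using D by (auto simp: gen_dickman_def)
  have pp: "point_process Q \<zeta>" using \<zeta> by (simp add: poisson_process_def)
  note lf = point_processD(2)[OF pp]
  let ?S = "\<lambda>\<omega>. \<integral>\<^sup>+t\<in>{0<..1}. ennreal t \<partial>\<zeta> \<omega>" and ?S' = "\<lambda>\<omega>. \<integral>\<^sup>+t\<in>{0<..<1}. ennreal t \<partial>\<zeta> \<omega>"
  have [measurable]: "?S \<in> borel_measurable Q" "?S' \<in> borel_measurable Q"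
    by (intro measurable_nn_integral_point_process[OF pp] identity_on_measurable; simp)+
  have fin: "AE \<omega> in Q. ?S \<omega> \<noteq> \<infinity>"
    using dickman_mean_near_0[OF \<zeta> \<open>c > 0\<close>, of 1] by (intro nn_integral_PInf_AE) auto
  have one: "{1} \<in> sets pos_borel" by (auto simp: sets_restrict_space image_iff intro!: bexI[of _ "{1}"])
  have "(\<integral>\<^sup>+t. indicator {1} t \<partial>dickman_intensity c) =
      (\<integral>\<^sup>+t. ennreal (c / t) * indicator {1} t * indicator {0<..} t \<partial>lborel)"
    using one by (intro nn_integral_dickman_intensity) simp
  also have "\<dots> = (\<integral>\<^sup>+t. ennreal c * indicator {1::real} t \<partial>lborel)"
    by (intro nn_integral_cong) (auto split: split_indicator)
  also have "\<dots> = 0" by (simp add: nn_integral_cmult_indicator)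
  finally have "(\<integral>\<^sup>+\<omega>. (\<integral>\<^sup>+t. indicator {1} t \<partial>\<zeta> \<omega>) \<partial>Q) = 0"
    using one by (subst poisson_process_mean[OF \<zeta> sets_dickman_intensity]) auto
  then have "AE \<omega> in Q. (\<integral>\<^sup>+t. indicator {1} t \<partial>\<zeta> \<omega>) = 0"
    using measurable_nn_integral_point_process[OF pp, of "indicator {1}"] one
    by (subst (asm) nn_integral_0_iff_AE) auto
  then have eq: "AE \<omega> in Q. ?S' \<omega> = ?S \<omega>"
  proof (rule AE_mp, intro AE_I2 impI)
    fix \<omega> assume \<omega>: "\<omega> \<in> space Q" "(\<integral>\<^sup>+t. indicator {1} t \<partial>\<zeta> \<omega>) = 0"
    have "{1} \<in> null_sets (\<zeta> \<omega>)"
      using \<omega> one by (auto simp: lf_measuresD[OF lf[OF \<omega>(1)]])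
    then have "AE t in \<zeta> \<omega>. t \<notin> {1}" by (rule AE_not_in)
    then show "?S' \<omega> = ?S \<omega>"
      by (intro nn_integral_cong_AE) (auto elim!: eventually_mono split: split_indicator)
  qed
  have "distr P borel (\<lambda>x. ennreal (D x)) = distr (distr P borel D) borel ennreal"
    by (simp add: distr_distr o_def)
  also have "\<dots> = distr Q borel (\<lambda>\<omega>. ennreal (enn2real (?S' \<omega>)))"
    unfolding law by (simp add: distr_distr o_def)
  also have "\<dots> = distr Q borel ?S"
  proof (rule distr_cong_AE)
    show "AE \<omega> in Q. ennreal (enn2real (?S' \<omega>)) = ?S \<omega>"
      using fin eq by eventually_elim (simp add: less_top)
  qed simp_all
  also have "\<dots> = distr N borel (\<lambda>\<omega>. \<integral>\<^sup>+t\<in>{0<..1}. ennreal t \<partial>\<eta> \<omega>)"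
    by (intro poisson_process_integral_law_unique[OF \<zeta> \<eta>] identity_on_measurable) simp
  finally show ?thesis ..
qed


section \<open>Removing the truncation\<close>

lemma continuous_on_enn2real_min_1: "continuous_on UNIV (\<lambda>x. enn2real (min 1 x))"
  unfolding continuous_on_def
proof (intro ballI tendsto_enn2real)
  fix x :: ennreal
  show "(min 1 \<longlongrightarrow> ennreal (enn2real (min 1 x))) (at x)"
    using tendsto_min[OF tendsto_const[of "1::ennreal"] tendsto_ident_at[of x UNIV]]
    by (simp add: min_less_iff_disj)
qed simp

lemma enn2real_min_1_le: "enn2real (min 1 x) \<le> 1"
  using enn2real_mono[of "min 1 x" 1] by simp

lemma nn_integral_min_1:
  assumes "prob_space L" and X [measurable]: "X \<in> borel_measurable L"
  shows "(\<integral>\<^sup>+\<omega>. min 1 (X \<omega>) \<partial>L) = ennreal (\<integral>\<omega>. enn2real (min 1 (X \<omega>)) \<partial>L)"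
proof -
  interpret prob_space L by fact
  have "integrable L (\<lambda>\<omega>. enn2real (min 1 (X \<omega>)))"
    using enn2real_min_1_le by (intro integrable_const_bound[of _ 1]) auto
  then have "(\<integral>\<^sup>+\<omega>. ennreal (enn2real (min 1 (X \<omega>))) \<partial>L) = ennreal (\<integral>\<omega>. enn2real (min 1 (X \<omega>)) \<partial>L)"
    by (intro nn_integral_eq_integral) auto
  then show ?thesis by (simp add: min_less_iff_disj)
qed

lemma overshoot_integral_measurable:
  assumes "point_process L \<xi>" "0 < \<epsilon>" "\<epsilon> < 1"
  shows "(\<lambda>\<omega>. \<integral>\<^sup>+t. ennreal (overshoot \<epsilon> t) \<partial>\<xi> \<omega>) \<in> borel_measurable L"
  using assms
  by (intro measurable_nn_integral_point_process vague_test_function_measurable overshoot_test) auto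

text \<open>The tolerance \<open>r\<close> is spent in six parts \<open>e\<close>: three for truncating the approximating process, one
  for the convergence of the truncated sums, two for truncating the limit.\<close>

lemma dickman_sum_convergence:
  fixes M :: "nat \<Rightarrow> 'a measure" and \<nu> :: "nat \<Rightarrow> 'a \<Rightarrow> real measure"
    and N :: "'b measure" and \<eta> :: "'b \<Rightarrow> real measure"
  assumes c: "c > 0" and \<nu>: "\<And>n. point_process (M n) (\<nu> n)"
    and \<eta>: "poisson_process (dickman_intensity c) N \<eta>"
    and conv: "conv_in_distribution vague_topology M \<nu> N \<eta>"
    and small: "((\<lambda>\<epsilon>::real. limsup (\<lambda>n. \<integral>\<^sup>+\<omega>. (\<integral>\<^sup>+t\<in>{0<..\<epsilon>}. ennreal t \<partial>\<nu> n \<omega>) \<partial>M n)) \<longlongrightarrow> 0) (at_right 0)"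
  shows "conv_in_distribution euclidean
           M (\<lambda>n \<omega>. \<integral>\<^sup>+t\<in>{0<..1}. ennreal t \<partial>\<nu> n \<omega>)
           N (\<lambda>\<omega>. \<integral>\<^sup>+t\<in>{0<..1}. ennreal t \<partial>\<eta> \<omega>)"
  unfolding conv_in_distribution_def
proof (intro allI impI)
  fix F :: "ennreal \<Rightarrow> real"
  assume "continuous_map euclidean euclidean F" and bdd: "bounded (F ` topspace euclidean)"
  then have F: "continuous_on UNIV F" by simp
  obtain B where "B > 0" and B: "\<And>x. \<bar>F x\<bar> \<le> B" using bdd by (auto simp: bounded_pos)
  have pp\<eta>: "point_process N \<eta>" using \<eta> by (simp add: poisson_process_def)
  interpret N: prob_space N using point_processD(1)[OF pp\<eta>] .
  let ?a = "\<lambda>n. \<integral>\<omega>. F (\<integral>\<^sup>+t\<in>{0<..1}. ennreal t \<partial>\<nu> n \<omega>) \<partial>M n"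
  let ?b = "\<integral>\<omega>. F (\<integral>\<^sup>+t\<in>{0<..1}. ennreal t \<partial>\<eta> \<omega>) \<partial>N"
  show "?a \<longlonglongrightarrow> ?b"
  proof (rule LIMSEQ_I)
    fix r :: real assume "r > 0"
    define e where "e = r / 6"
    have e: "e > 0" using \<open>r > 0\<close> by (simp add: e_def)
    obtain d where d: "d > 0" and
      unif: "\<And>x y. x \<le> y + ennreal d \<Longrightarrow> y \<le> x + ennreal d \<Longrightarrow> \<bar>F x - F y\<bar> < e"
      using continuous_ennreal_uniform[OF F e] by blast
    \<comment> \<open>The constant in front of the mean of \<open>R\<close> in the truncation error.\<close>
    define K where "K = 2 * B / d"
    have K: "K > 0" using \<open>B > 0\<close> d by (simp add: K_def)
    \<comment> \<open>The slack lost twice for finite \<open>n\<close>: in the hypothesis on the mean of \<open>R\<close>, and in the convergence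
      of the mean of \<open>min 1 H\<close>. Together the two losses cost \<open>e\<close>.\<close>
    define \<rho> where "\<rho> = e / (K + 2 * B)"
    have \<rho>: "\<rho> > 0" using e K \<open>B > 0\<close> by (simp add: \<rho>_def)
    have K\<rho>: "K * \<rho> + 2 * B * \<rho> = e"
    proof -
      have "K * \<rho> + 2 * B * \<rho> = (K + 2 * B) * \<rho>" by (rule distrib_right[symmetric])
      also have "\<dots> = e" using K \<open>B > 0\<close> by (simp add: \<rho>_def)
      finally show ?thesis .
    qed
    \<comment> \<open>For the limit process the means of \<open>R\<close> and \<open>H\<close> are at most \<open>c * \<epsilon>\<close> and \<open>6 * c * \<epsilon>\<close>; this
      threshold makes their contribution at most \<open>e\<close>.\<close>
    define \<epsilon>0 where "\<epsilon>0 = min (1 / 2) (e / (K * c + 12 * B * c))"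
    have \<epsilon>0: "\<epsilon>0 > 0" using e K \<open>B > 0\<close> c by (simp add: \<epsilon>0_def add_pos_pos)
    have "\<forall>\<^sub>F \<epsilon> in at_right 0. limsup (\<lambda>n. \<integral>\<^sup>+\<omega>. (\<integral>\<^sup>+t\<in>{0<..\<epsilon>}. ennreal t \<partial>\<nu> n \<omega>) \<partial>M n) < ennreal \<rho>"
      using \<rho> by (intro order_tendstoD(2)[OF small]) simp
    moreover have "\<forall>\<^sub>F \<epsilon> in at_right 0. \<epsilon> \<in> {0<..<\<epsilon>0}"
      using \<epsilon>0 by (rule eventually_at_right_real)
    ultimately have "\<forall>\<^sub>F \<epsilon> in at_right (0::real). \<epsilon> \<in> {0<..<\<epsilon>0} \<and>
        limsup (\<lambda>n. \<integral>\<^sup>+\<omega>. (\<integral>\<^sup>+t\<in>{0<..\<epsilon>}. ennreal t \<partial>\<nu> n \<omega>) \<partial>M n) < ennreal \<rho>"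
      by eventually_elim (rule conjI)
    from eventually_happens'[OF trivial_limit_at_right_real this]
    obtain \<epsilon> where "\<epsilon> \<in> {0<..<\<epsilon>0}"
      and limsup: "limsup (\<lambda>n. \<integral>\<^sup>+\<omega>. (\<integral>\<^sup>+t\<in>{0<..\<epsilon>}. ennreal t \<partial>\<nu> n \<omega>) \<partial>M n) < ennreal \<rho>"
      by blast
    then have \<epsilon>: "0 < \<epsilon>" "\<epsilon> < 1 / 2" "\<epsilon> < e / (K * c + 12 * B * c)"
      by (auto simp: \<epsilon>0_def)
    have small_\<epsilon>: "K * (c * \<epsilon>) + 2 * B * (6 * c * \<epsilon>) \<le> e"
      using \<epsilon>(3) K \<open>B > 0\<close> c by (simp add: less_divide_eq add_pos_pos algebra_simps)

    let ?Tn = "\<lambda>n. \<integral>\<omega>. F (\<integral>\<^sup>+t. ennreal (truncated_identity \<epsilon> t) \<partial>\<nu> n \<omega>) \<partial>M n"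
    let ?T = "\<integral>\<omega>. F (\<integral>\<^sup>+t. ennreal (truncated_identity \<epsilon> t) \<partial>\<eta> \<omega>) \<partial>N"
    let ?Hn = "\<lambda>n. \<integral>\<omega>. enn2real (min 1 (\<integral>\<^sup>+t. ennreal (overshoot \<epsilon> t) \<partial>\<nu> n \<omega>)) \<partial>M n"
    let ?H = "\<integral>\<omega>. enn2real (min 1 (\<integral>\<^sup>+t. ennreal (overshoot \<epsilon> t) \<partial>\<eta> \<omega>)) \<partial>N"
    have T_lim: "?Tn \<longlonglongrightarrow> ?T"
      using \<epsilon> bdd by (intro conv_in_distribution_vague_integral[OF conv \<nu> pp\<eta> _ F] truncated_identity_test) auto
    have H_lim: "?Hn \<longlonglongrightarrow> ?H"
      using \<epsilon> enn2real_min_1_le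
      by (intro conv_in_distribution_vague_integral[OF conv \<nu> pp\<eta> _ continuous_on_enn2real_min_1] overshoot_test)
         (auto simp: bounded_iff)
    define EH where "EH = 6 * c * \<epsilon>"
    have EH: "EH \<ge> 0" using c \<epsilon> by (simp add: EH_def)
    have "(\<integral>\<^sup>+\<omega>. min 1 (\<integral>\<^sup>+t. ennreal (overshoot \<epsilon> t) \<partial>\<eta> \<omega>) \<partial>N)
        \<le> (\<integral>\<^sup>+\<omega>. (\<integral>\<^sup>+t. ennreal (overshoot \<epsilon> t) \<partial>\<eta> \<omega>) \<partial>N)"
      by (rule nn_integral_mono) simp
    also have "\<dots> \<le> ennreal EH"
      using \<epsilon> unfolding EH_def by (intro dickman_mean_overshoot[OF \<eta> c]) auto
    finally have "(\<integral>\<^sup>+\<omega>. min 1 (\<integral>\<^sup>+t. ennreal (overshoot \<epsilon> t) \<partial>\<eta> \<omega>) \<partial>N) \<le> ennreal EH" .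
    then have H_small: "(\<integral>\<^sup>+\<omega>. min 1 (\<integral>\<^sup>+t. ennreal (overshoot \<epsilon> t) \<partial>\<eta> \<omega>) \<partial>N) \<le> ennreal EH" "?H \<le> EH"
      using \<epsilon> EH by (auto simp: nn_integral_min_1[OF N.prob_space_axioms] overshoot_integral_measurable[OF pp\<eta>])
    have T_near: "\<bar>?b - ?T\<bar> \<le> 2 * e"
    proof -
      have "ennreal \<bar>?b - ?T\<bar> \<le> ennreal e + ennreal (2 * B / d) * (\<integral>\<^sup>+\<omega>. (\<integral>\<^sup>+t\<in>{0<..\<epsilon>}. ennreal t \<partial>\<eta> \<omega>) \<partial>N)
          + ennreal (2 * B) * (\<integral>\<^sup>+\<omega>. min 1 (\<integral>\<^sup>+t. ennreal (overshoot \<epsilon> t) \<partial>\<eta> \<omega>) \<partial>N)"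
        using \<epsilon> by (intro expected_truncation_error[OF pp\<eta> F _ _ d e B unif]) auto
      also have "\<dots> \<le> ennreal e + ennreal K * ennreal (c * \<epsilon>) + ennreal (2 * B) * ennreal EH"
        using H_small(1) \<epsilon> c unfolding K_def[symmetric]
        by (intro add_mono mult_left_mono) (auto simp: dickman_mean_near_0[OF \<eta>])
      also have "\<dots> = ennreal (e + K * (c * \<epsilon>) + 2 * B * EH)"
        using e K c \<epsilon> \<open>B > 0\<close> EH by (simp add: ennreal_mult ennreal_plus)
      finally have "\<bar>?b - ?T\<bar> \<le> e + K * (c * \<epsilon>) + 2 * B * EH"
        using e K c \<epsilon> \<open>B > 0\<close> EH by (subst (asm) ennreal_le_iff) auto
      then show ?thesis using small_\<epsilon> by (simp add: EH_def)
    qed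
    have Tn_near: "\<bar>?a n - ?Tn n\<bar> \<le> 3 * e"
      if R: "(\<integral>\<^sup>+\<omega>. (\<integral>\<^sup>+t\<in>{0<..\<epsilon>}. ennreal t \<partial>\<nu> n \<omega>) \<partial>M n) < ennreal \<rho>" and H: "?Hn n < EH + \<rho>" for n
    proof -
      have "(\<integral>\<^sup>+\<omega>. min 1 (\<integral>\<^sup>+t. ennreal (overshoot \<epsilon> t) \<partial>\<nu> n \<omega>) \<partial>M n) = ennreal (?Hn n)"
        using \<epsilon> by (intro nn_integral_min_1 point_processD(1)[OF \<nu>] overshoot_integral_measurable[OF \<nu>]) auto
      also have "\<dots> \<le> ennreal (EH + \<rho>)" using H by (intro ennreal_leI) simp
      finally have H': "(\<integral>\<^sup>+\<omega>. min 1 (\<integral>\<^sup>+t. ennreal (overshoot \<epsilon> t) \<partial>\<nu> n \<omega>) \<partial>M n) \<le> ennreal (EH + \<rho>)" .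
      have "ennreal \<bar>?a n - ?Tn n\<bar> \<le> ennreal e + ennreal (2 * B / d) * (\<integral>\<^sup>+\<omega>. (\<integral>\<^sup>+t\<in>{0<..\<epsilon>}. ennreal t \<partial>\<nu> n \<omega>) \<partial>M n)
          + ennreal (2 * B) * (\<integral>\<^sup>+\<omega>. min 1 (\<integral>\<^sup>+t. ennreal (overshoot \<epsilon> t) \<partial>\<nu> n \<omega>) \<partial>M n)"
        using \<epsilon> by (intro expected_truncation_error[OF \<nu> F _ _ d e B unif]) auto
      also have "\<dots> \<le> ennreal e + ennreal K * ennreal \<rho> + ennreal (2 * B) * ennreal (EH + \<rho>)"
        using R H' unfolding K_def[symmetric] by (intro add_mono mult_left_mono) auto
      also have "\<dots> = ennreal (e + K * \<rho> + 2 * B * (EH + \<rho>))"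
        using e K \<rho> \<open>B > 0\<close> EH by (simp add: ennreal_mult[symmetric] flip: ennreal_plus)
      finally have "\<bar>?a n - ?Tn n\<bar> \<le> e + K * \<rho> + 2 * B * (EH + \<rho>)"
        using e K \<rho> \<open>B > 0\<close> EH by (subst (asm) ennreal_le_iff) auto
      also have "\<dots> = e + (K * \<rho> + 2 * B * \<rho>) + 2 * B * EH" by (simp add: algebra_simps)
      also have "\<dots> \<le> 3 * e"
      proof -
        have "0 \<le> K * (c * \<epsilon>)" using K c \<epsilon> by simp
        then show ?thesis using K\<rho> small_\<epsilon> unfolding EH_def by linarith
      qed
      finally show ?thesis .
    qed
    have "\<forall>\<^sub>F n in sequentially. norm (?a n - ?b) < r"
    proof -
      have "\<forall>\<^sub>F n in sequentially. \<bar>?Tn n - ?T\<bar> < e"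
        using tendstoD[OF T_lim e] by (simp add: dist_real_def)
      moreover have "\<forall>\<^sub>F n in sequentially. ?Hn n < EH + \<rho>"
        using H_small(2) \<rho> by (intro order_tendstoD(2)[OF H_lim]) linarith
      moreover have "\<forall>\<^sub>F n in sequentially. (\<integral>\<^sup>+\<omega>. (\<integral>\<^sup>+t\<in>{0<..\<epsilon>}. ennreal t \<partial>\<nu> n \<omega>) \<partial>M n) < ennreal \<rho>"
        by (rule Limsup_lessD[OF limsup])
      ultimately show ?thesis
      proof eventually_elim
        case (elim n)
        then show ?case using Tn_near[OF elim(3) elim(2)] T_near e unfolding e_def real_norm_def by linarith
      qed
    qed
    then show "\<exists>no. \<forall>n\<ge>no. norm (?a n - ?b) < r" by (simp add: eventually_sequentially)
  qed
qed


theorem lemmaA3: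
  fixes c :: real
    and M :: "nat \<Rightarrow> 'a measure" and \<nu> :: "nat \<Rightarrow> 'a \<Rightarrow> real measure"
    and N :: "'b measure" and \<eta> :: "'b \<Rightarrow> real measure"
    and P :: "'d measure" and D :: "'d \<Rightarrow> real"
  assumes "c > 0"
    and "\<And>n. point_process (M n) (\<nu> n)"
    and "poisson_process (dickman_intensity c) N \<eta>"
    and "gen_dickman c P D"
    and "conv_in_distribution vague_topology M \<nu> N \<eta>"
    and "((\<lambda>\<epsilon>::real. limsup (\<lambda>n. \<integral>\<^sup>+\<omega>. (\<integral>\<^sup>+t\<in>{0<..\<epsilon>}. ennreal t \<partial>\<nu> n \<omega>) \<partial>M n)) \<longlongrightarrow> 0) (at_right 0)"
  shows "conv_in_distribution euclidean
           M (\<lambda>n \<omega>. \<integral>\<^sup>+t\<in>{0<..1}. ennreal t \<partial>\<nu> n \<omega>)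
           N (\<lambda>\<omega>. \<integral>\<^sup>+t\<in>{0<..1}. ennreal t \<partial>\<eta> \<omega>)
       \<and> distr N borel (\<lambda>\<omega>. \<integral>\<^sup>+t\<in>{0<..1}. ennreal t \<partial>\<eta> \<omega>) = distr P borel (\<lambda>x. ennreal (D x))"
  using dickman_sum_convergence[OF assms(1-3,5,6)] dickman_law[OF assms(1,3,4)] by (rule conjI)

end
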